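(* Over the family of 3-periodics of $E$: (i) the locus of the orthocenter $X_4$ (triangle center function $h=\dfrac{1}{s_1(s_2^2+s_3^2-s_1^2)}$), taken as the closure of its set of defined positions, is the ellipse $x^2/a_4^2+y^2/b_4^2=1$ with $a_4=k_4/a$, $b_4=k_4/b$, where $k_4=\dfrac{(a^2+b^2)\delta-2a^2b^2}{c^2}$; (ii) the locus of the Spieker center $X_{10}$ ($h=\dfrac{s_2+s_3}{s_1}$) is the ellipse $x^2/a_{10}^2+y^2/b_{10}^2=1$ with $a_{10}=k_{10}/a$, $b_{10}=k_{10}/b$, where $k_{10}=\dfrac{(a^2+b^2)\delta-a^4-b^4}{2c^2}$. In particular both loci are ellipses similar to a $90^\circ$-rotated copy of $E$.
   Context: Fix real numbers $a>b>0$, let $E$ be the ellipse $x^2/a^2+y^2/b^2=1$, $c^2=a^2-b^2$ and $\delta=\sqrt{a^4-a^2b^2+b^4}$. A 3-periodic is a non-degenerate triangle $P_1P_2P_3$ with all vertices on $E$ such that at each vertex $P_j$ the normal line to $E$ at $P_j$ bisects the interior angle of the triangle at $P_j$. For a triangle let $s_1=|P_2P_3|$, $s_2=|P_3P_1|$, $s_3=|P_1P_2|$. Given a triangle center function $h(s_1,s_2,s_3)$, the center $X_h$ is the point with trilinears $p:q:r=h(s_1,s_2,s_3):h(s_2,s_3,s_1):h(s_3,s_1,s_2)$, i.e. the Cartesian point $\dfrac{p s_1P_1+q s_2P_2+r s_3P_3}{p s_1+q s_2+r s_3}$ (equivalently, after clearing denominators in $p,q,r$ by a common factor). The locus of $X_h$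 is the set of points $X_h(T)$ over all 3-periodics $T$ for which it is defined. *)

theory Defs
  imports "HOL-Analysis.Analysis"
begin

type_synonym pt = "real \<times> real"

definition on_ellipse :: "real \<Rightarrow> real \<Rightarrow> pt \<Rightarrow> bool" where
  "on_ellipse a b P \<longleftrightarrow> (fst P)\<^sup>2 / a\<^sup>2 + (snd P)\<^sup>2 / b\<^sup>2 = 1"

definition cross2 :: "pt \<Rightarrow> pt \<Rightarrow> real" where
  "cross2 u v = fst u * snd v - snd u * fst v"

definition nondegenerate :: "pt \<Rightarrow> pt \<Rightarrow> pt \<Rightarrow> bool" where
  "nondegenerate P Q R \<longleftrightarrow> cross2 (Q - P) (R - P) \<noteq> 0"

text \<open>The normal line to E at P (direction (x/a^2, y/b^2)) bisects the interior angle
  of the triangle at vertex P with neighbouring vertices Q, R: the interior bisector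
  direction u + v (u, v unit vectors from P towards Q, R) is parallel to the normal.\<close>
definition normal_bisects :: "real \<Rightarrow> real \<Rightarrow> pt \<Rightarrow> pt \<Rightarrow> pt \<Rightarrow> bool" where
  "normal_bisects a b P Q R \<longleftrightarrow>
     cross2 ((1 / norm (Q - P)) *\<^sub>R (Q - P) + (1 / norm (R - P)) *\<^sub>R (R - P))
            (fst P / a\<^sup>2, snd P / b\<^sup>2) = 0"

definition three_periodic :: "real \<Rightarrow> real \<Rightarrow> pt \<Rightarrow> pt \<Rightarrow> pt \<Rightarrow> bool" where
  "three_periodic a b P1 P2 P3 \<longleftrightarrow>
     nondegenerate P1 P2 P3 \<and>
     on_ellipse a b P1 \<and> on_ellipse a b P2 \<and> on_ellipse a b P3 \<and>
     normal_bisects a b P1 P2 P3 \<and> normal_bisects a b P2 P3 P1 \<and>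
     normal_bisects a b P3 P1 P2"

text \<open>A triangle center function is partial: None where it is undefined
  (e.g. division by zero).\<close>
type_synonym center_fun = "real \<Rightarrow> real \<Rightarrow> real \<Rightarrow> real option"

definition center_defined :: "center_fun \<Rightarrow> pt \<Rightarrow> pt \<Rightarrow> pt \<Rightarrow> bool" where
  "center_defined h P1 P2 P3 \<longleftrightarrow>
     (let s1 = dist P2 P3; s2 = dist P3 P1; s3 = dist P1 P2 in
      h s1 s2 s3 \<noteq> None \<and> h s2 s3 s1 \<noteq> None \<and> h s3 s1 s2 \<noteq> None \<and>
      the (h s1 s2 s3) * s1 + the (h s2 s3 s1) * s2 + the (h s3 s1 s2) * s3 \<noteq> 0)"

definition center :: "center_fun \<Rightarrow> pt \<Rightarrow> pt \<Rightarrow> pt \<Rightarrow> pt" where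
  "center h P1 P2 P3 =
     (let s1 = dist P2 P3; s2 = dist P3 P1; s3 = dist P1 P2;
          p = the (h s1 s2 s3); q = the (h s2 s3 s1); r = the (h s3 s1 s2) in
      (1 / (p * s1 + q * s2 + r * s3)) *\<^sub>R
        ((p * s1) *\<^sub>R P1 + (q * s2) *\<^sub>R P2 + (r * s3) *\<^sub>R P3))"

definition locus :: "real \<Rightarrow> real \<Rightarrow> center_fun \<Rightarrow> pt set" where
  "locus a b h = {center h P1 P2 P3 | P1 P2 P3.
                    three_periodic a b P1 P2 P3 \<and> center_defined h P1 P2 P3}"

definition h_X4 :: center_fun where
  "h_X4 s1 s2 s3 = (if s1 * (s2\<^sup>2 + s3\<^sup>2 - s1\<^sup>2) = 0 then None
                    else Some (1 / (s1 * (s2\<^sup>2 + s3\<^sup>2 - s1\<^sup>2))))"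

definition h_X10 :: center_fun where
  "h_X10 s1 s2 s3 = (if s1 = 0 then None else Some ((s2 + s3) / s1))"

definition ellipse_set :: "real \<Rightarrow> real \<Rightarrow> pt set" where
  "ellipse_set A B = {P. (fst P)\<^sup>2 / A\<^sup>2 + (snd P)\<^sup>2 / B\<^sup>2 = 1}"

end

theory Submission
  imports Defs "HOL-Computational_Algebra.Fundamental_Theorem_Algebra"
begin

text \<open>Write the vertices as \<open>(a Re u, b Im u)\<close> with \<open>u\<close> on the unit circle. The bisector condition
  says that \<open>(1 - Re (u * cnj v)) / |PQ|\<close> is the same number \<open>J\<close> for all three sides (Joachimsthal's
  constant). Squared, this is a relation of bidegree (2, 2) between \<open>u\<close> and \<open>v\<close>; three distinct
  pairwise related points exist only for \<open>J\<^sup>2 c\<^sup>2 = k\<close> with \<open>k = (2 \<delta> - a\<^sup>2 - b\<^sup>2) / c\<^sup>2\<close>, and then they are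
  the solutions of \<open>z (z\<^sup>2 - k) / (1 - k z\<^sup>2) = s\<close> for a unit number \<open>s\<close>, their product. The left side is a
  Blaschke product of degree 3, so every unit \<open>s\<close> does arise from three distinct unit solutions.
  Both centers are symmetric functions of the solutions, hence functions of \<open>s\<close>, and come out as
  \<open>(- (\<kappa> / a) Re s, - (\<kappa> / b) Im s)\<close>. An orthocenter fails to be defined only at a right angle, where it is
  a vertex; so the missing positions lie on the intersection of two different concentric
  ellipses, which is finite.\<close>

section \<open>The bisector condition as Joachimsthal's relation\<close>

definition ellipse_pt :: "real \<Rightarrow> real \<Rightarrow> complex \<Rightarrow> pt" where
  "ellipse_pt a b u = (a * Re u, b * Im u)"

lemma on_ellipse_iff:
  assumes "a > 0" "b > 0"
  shows "on_ellipse a b P \<longleftrightarrow> (\<exists>u. cmod u = 1 \<and> P = ellipse_pt a b u)"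
proof
  assume "on_ellipse a b P"
  then have "cmod (Complex (fst P / a) (snd P / b)) = 1"
    by (simp add: on_ellipse_def cmod_def power_divide)
  moreover have "P = ellipse_pt a b (Complex (fst P / a) (snd P / b))"
    using assms by (simp add: ellipse_pt_def)
  ultimately show "\<exists>u. cmod u = 1 \<and> P = ellipse_pt a b u" by blast
next
  assume "\<exists>u. cmod u = 1 \<and> P = ellipse_pt a b u"
  then show "on_ellipse a b P"
    using assms by (auto simp: on_ellipse_def ellipse_pt_def cmod_def power_mult_distrib)
qed

lemma ellipse_pt_inj:
  "\<lbrakk>a \<noteq> 0; b \<noteq> 0\<rbrakk> \<Longrightarrow> ellipse_pt a b u = ellipse_pt a b v \<longleftrightarrow> u = v"
  by (auto simp: ellipse_pt_def complex_eq_iff)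

lemma unit_sq: "cmod u = 1 \<Longrightarrow> (Re u)\<^sup>2 + (Im u)\<^sup>2 = 1"
  by (metis cmod_power2 one_power2)

lemma unit_mult_cnj: "cmod u = 1 \<Longrightarrow> u * cnj u = 1"
  by (simp add: complex_norm_square[symmetric])

lemma one_minus_Re_mult_cnj:
  assumes "cmod u = 1" "cmod v = 1"
  shows "1 - Re (u * cnj v) = (cmod (u - v))\<^sup>2 / 2"
  using unit_sq[OF assms(1)] unit_sq[OF assms(2)]
  unfolding cmod_power2 by (simp add: power2_eq_square algebra_simps)

lemma Re_mult_cnj_less_1:
  assumes "cmod u = 1" "cmod v = 1" "u \<noteq> v"
  shows "0 < 1 - Re (u * cnj v)"
  using assms(3) by (subst one_minus_Re_mult_cnj[OF assms(1,2)]) simp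

text \<open>With \<open>u\<close>, \<open>v\<close> at eccentric angles s, t, both coordinate
  differences contain the factor sin((s-t)/2), and 1 - cos(s-t) is twice its square. The other
  factor is a^2 (1 - cos(s+t)) + b^2 (1 + cos(s+t)).\<close>

lemma dist_ellipse_pt_sq:
  assumes "cmod u = 1" "cmod v = 1"
  shows "(dist (ellipse_pt a b u) (ellipse_pt a b v))\<^sup>2 =
    (1 - Re (u * cnj v)) * (a\<^sup>2 + b\<^sup>2 - (a\<^sup>2 - b\<^sup>2) * Re (u * v))"
proof -
  have "(dist (ellipse_pt a b u) (ellipse_pt a b v))\<^sup>2
      = a\<^sup>2 * (Re u - Re v)\<^sup>2 + b\<^sup>2 * (Im u - Im v)\<^sup>2"
    by (simp add: dist_Pair_Pair ellipse_pt_def dist_real_def,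
        simp add: power2_eq_square algebra_simps)
  also have "\<dots> = (1 - Re (u * cnj v)) * (a\<^sup>2 + b\<^sup>2 - (a\<^sup>2 - b\<^sup>2) * Re (u * v))"
    using unit_sq[OF assms(1)] unit_sq[OF assms(2)]
    by simp algebra
  finally show ?thesis .
qed

text \<open>Split \<open>p\<close> and \<open>q\<close> into components along and across
  \<open>n\<close>. Equal lengths make one pair of components agree up to sign exactly when the
  other pair does; the negative inner products fix the sign along \<open>n\<close>, and
  \<open>p \<noteq> q\<close> fixes it across \<open>n\<close>.\<close>

lemma unit_bisector_iff:
  fixes p q n :: pt
  assumes p: "norm p = 1" and q: "norm q = 1" and "p \<noteq> q"
    and neg: "inner p n < 0" "inner q n < 0"
  shows "cross2 (p + q) n = 0 \<longleftrightarrow> inner p n = inner q n"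
proof -
  obtain p1 p2 q1 q2 n1 n2 where e: "p = (p1,p2)" "q = (q1,q2)" "n = (n1,n2)"
    by (metis surj_pair)
  have u: "p1\<^sup>2 + p2\<^sup>2 = 1" "q1\<^sup>2 + q2\<^sup>2 = 1"
    using p q by (simp_all add: e norm_Pair)
  \<comment> \<open>\<open>A\<close>, \<open>B\<close> are the components along \<open>n\<close> and
    \<open>C\<close>, \<open>D\<close> those across it, each scaled by the length of
    \<open>n\<close>; the cross product in question is \<open>C + D\<close>.\<close>
  define A B C D where "A = p1*n1 + p2*n2" and "B = q1*n1 + q2*n2"
    and "C = p1*n2 - p2*n1" and "D = q1*n2 - q2*n1"
  have AC: "A\<^sup>2 + C\<^sup>2 = n1\<^sup>2 + n2\<^sup>2" using u(1) unfolding A_def C_def by algebra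
  have BD: "B\<^sup>2 + D\<^sup>2 = n1\<^sup>2 + n2\<^sup>2" using u(2) unfolding B_def D_def by algebra
  have AB: "A < 0" "B < 0" using neg by (simp_all add: e A_def B_def)
  have "C + D = 0 \<longleftrightarrow> A = B"
  proof
    assume "C + D = 0"
    then have "C = - D" by simp
    then have "A\<^sup>2 = B\<^sup>2" using AC BD by simp
    then show "A = B" using AB by (auto simp: power2_eq_iff)
  next
    assume AB': "A = B"
    then have "C\<^sup>2 = D\<^sup>2" using AC BD by simp
    moreover have "C \<noteq> D"
    proof
      assume "C = D"
      have n: "n1\<^sup>2 + n2\<^sup>2 \<noteq> 0" using AB by (auto simp: A_def sum_power2_eq_zero_iff)
      have "(p1 - q1) * (n1\<^sup>2 + n2\<^sup>2) = 0"
        using AB' \<open>C = D\<close> unfolding A_def B_def C_def D_def by algebra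
      moreover have "(p2 - q2) * (n1\<^sup>2 + n2\<^sup>2) = 0"
        using AB' \<open>C = D\<close> unfolding A_def B_def C_def D_def by algebra
      ultimately show False using n \<open>p \<noteq> q\<close> by (auto simp: e)
    qed
    ultimately show "C + D = 0" by (auto simp: power2_eq_iff)
  qed
  then show ?thesis by (simp add: e cross2_def A_def B_def C_def D_def algebra_simps)
qed

text \<open>The signed area is \<open>a * b\<close> times that of the triangle on the unit circle.
  There \<open>cnj\<close> is inversion, so the area times \<open>u * v * w\<close> becomes, up to a
  constant, the product of the differences.\<close>

lemma nondegenerate_ellipse_pt_iff:
  assumes "a \<noteq> 0" "b \<noteq> 0" and u: "cmod u = 1" and v: "cmod v = 1" and w: "cmod w = 1"
  shows "nondegenerate (ellipse_pt a b u) (ellipse_pt a b v) (ellipse_pt a b w)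
     \<longleftrightarrow> u \<noteq> v \<and> v \<noteq> w \<and> w \<noteq> u"
proof -
  define X where "X = Im (cnj (v - u) * (w - u))"
  have "cross2 (ellipse_pt a b v - ellipse_pt a b u) (ellipse_pt a b w - ellipse_pt a b u) = a * b * X"
    by (simp add: cross2_def ellipse_pt_def X_def algebra_simps)
  then have "nondegenerate (ellipse_pt a b u) (ellipse_pt a b v) (ellipse_pt a b w) \<longleftrightarrow> X \<noteq> 0"
    using assms by (simp add: nondegenerate_def)
  moreover have "X = 0 \<longleftrightarrow> cnj (v - u) * (w - u) - (v - u) * cnj (w - u) = 0"
    by (auto simp: X_def complex_eq_iff algebra_simps)
  moreover have "u * v * w * (cnj (v - u) * (w - u) - (v - u) * cnj (w - u))
     = (v - u) * (w - u) * (v - w)"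
    using unit_mult_cnj[OF u] unit_mult_cnj[OF v] unit_mult_cnj[OF w]
    by simp algebra
  moreover have "u * v * w \<noteq> 0" using u v w by auto
  ultimately show ?thesis by (metis mult_eq_0_iff right_minus_eq)
qed

text \<open>Equal angles with the normal mean equal cosines. As the normal \<open>n\<close> is half
  the gradient of the quadratic form of E, pairing it with a chord from \<open>u\<close> to
  \<open>z\<close> yields \<open>Re (u * cnj z) - 1\<close>.\<close>

lemma normal_bisects_ellipse_pt_iff:
  assumes "a > 0" "b > 0" and u: "cmod u = 1" and v: "cmod v = 1" and w: "cmod w = 1"
    and d: "u \<noteq> v" "v \<noteq> w" "w \<noteq> u"
  shows "normal_bisects a b (ellipse_pt a b u) (ellipse_pt a b v) (ellipse_pt a b w)
   \<longleftrightarrow> (1 - Re (u * cnj v)) / dist (ellipse_pt a b u) (ellipse_pt a b v)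
     = (1 - Re (u * cnj w)) / dist (ellipse_pt a b u) (ellipse_pt a b w)"
proof -
  define P where "P = ellipse_pt a b"
  define n :: pt where "n = (fst (P u) / a\<^sup>2, snd (P u) / b\<^sup>2)"
  define e where "e = (\<lambda>z. (1 / norm (P z - P u)) *\<^sub>R (P z - P u))"
  have ne: "P z \<noteq> P u" if "z \<noteq> u" for z
    using that assms by (simp add: P_def ellipse_pt_inj)
  have n1: "norm (e z) = 1" if "z \<noteq> u" for z
    using ne[OF that] by (simp add: e_def)
  have inn: "inner (e z) n = - ((1 - Re (u * cnj z)) / dist (P u) (P z))" for z
  proof -
    have "inner (P z - P u) n = Re (u * cnj z) - ((Re u)\<^sup>2 + (Im u)\<^sup>2)"
      using assms by (simp add: n_def P_def ellipse_pt_def power2_eq_square field_simps)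
    then have "inner (P z - P u) n = - (1 - Re (u * cnj z))"
      using unit_sq[OF u] by simp
    then show ?thesis by (simp add: e_def dist_norm norm_minus_commute diff_divide_distrib)
  qed
  have neg: "inner (e z) n < 0" if "cmod z = 1" "z \<noteq> u" for z
    unfolding inn neg_less_0_iff_less using ne[OF that(2)] that
    by (intro divide_pos_pos Re_mult_cnj_less_1 u) auto
  \<comment> \<open>Equal directions would make the three vertices collinear.\<close>
  have "e v \<noteq> e w"
  proof
    assume eq: "e v = e w"
    have "cross2 (P v - P u) (P w - P u) = norm (P v - P u) * norm (P w - P u) * cross2 (e v) (e w)"
      using ne[of v] ne[of w] d by (simp add: e_def cross2_def field_simps)
    then have "cross2 (P v - P u) (P w - P u) = 0"
      by (simp add: eq cross2_def)
    with nondegenerate_ellipse_pt_iff[of a b u v w] assms show False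
      by (simp add: nondegenerate_def P_def)
  qed
  then have "cross2 (e v + e w) n = 0 \<longleftrightarrow> inner (e v) n = inner (e w) n"
    using d by (intro unit_bisector_iff n1 neg v w) auto
  then show ?thesis
    unfolding inn by (simp add: normal_bisects_def e_def n_def P_def)
qed


text \<open>Both sides are nonnegative, so squaring loses nothing. The squared distance contains the
  factor \<open>1 - Re (u * cnj v)\<close>, nonzero for distinct points; cancelling it removes the
  diagonal from the relation.\<close>

lemma Joachimsthal_iff:
  assumes "0 < J" "0 < a" "0 < b" and u: "cmod u = 1" and v: "cmod v = 1" and "u \<noteq> v"
  shows "1 - Re (u * cnj v) = J * dist (ellipse_pt a b u) (ellipse_pt a b v) \<longleftrightarrow>
     Re (u * cnj v) - J\<^sup>2 * (a\<^sup>2 - b\<^sup>2) * Re (u * v) = 1 - J\<^sup>2 * (a\<^sup>2 + b\<^sup>2)"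
proof -
  define d where "d = dist (ellipse_pt a b u) (ellipse_pt a b v)"
  define c where "c = 1 - Re (u * cnj v)"
  have c: "0 < c" using Re_mult_cnj_less_1[OF u v \<open>u \<noteq> v\<close>] by (simp add: c_def)
  have "c = J * d \<longleftrightarrow> c\<^sup>2 = (J * d)\<^sup>2"
    using c \<open>0 < J\<close> by (subst power2_eq_iff_nonneg) (auto simp: d_def)
  also have "(J * d)\<^sup>2 = J\<^sup>2 * (c * (a\<^sup>2 + b\<^sup>2 - (a\<^sup>2 - b\<^sup>2) * Re (u * v)))"
    unfolding power_mult_distrib d_def dist_ellipse_pt_sq[OF u v] c_def ..
  also have "c\<^sup>2 = \<dots> \<longleftrightarrow> c * c = c * (J\<^sup>2 * (a\<^sup>2 + b\<^sup>2 - (a\<^sup>2 - b\<^sup>2) * Re (u * v)))"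
    by (simp only: power2_eq_square[of c] mult_ac)
  also have "\<dots> \<longleftrightarrow> c = J\<^sup>2 * (a\<^sup>2 + b\<^sup>2 - (a\<^sup>2 - b\<^sup>2) * Re (u * v))"
    using c by simp
  finally show ?thesis unfolding c_def d_def by (simp add: algebra_simps) argo
qed

text \<open>Writing real parts with conjugates, replacing \<open>cnj\<close> by inversion and
  multiplying by \<open>2 * u * v\<close> turns the real equation into a polynomial one, which
  allows elimination by ring identities.\<close>

lemma unit_chord_relation_iff:
  fixes k g :: real
  assumes u: "cmod u = 1" and v: "cmod v = 1"
  shows "Re (u * cnj v) - k * Re (u * v) = g \<longleftrightarrow>
    u\<^sup>2 + v\<^sup>2 - of_real k * (u\<^sup>2 * v\<^sup>2 + 1) = 2 * of_real g * (u * v)"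
proof -
  define r where "r = Re (u * cnj v) - k * Re (u * v) - g"
  have "2 * complex_of_real r = (u * cnj v + cnj u * v) - of_real k * (u * v + cnj u * cnj v) - 2 * of_real g"
    by (simp add: r_def complex_eq_iff)
  then have "u\<^sup>2 + v\<^sup>2 - of_real k * (u\<^sup>2 * v\<^sup>2 + 1) - 2 * of_real g * (u * v) = 2 * of_real r * (u * v)"
    using unit_mult_cnj[OF u] unit_mult_cnj[OF v] by algebra
  moreover have "u * v \<noteq> 0" using u v by auto
  ultimately have "r = 0 \<longleftrightarrow> u\<^sup>2 + v\<^sup>2 - of_real k * (u\<^sup>2 * v\<^sup>2 + 1) = 2 * of_real g * (u * v)"
    by (metis (no_types, lifting) mult_eq_0_iff of_real_eq_0_iff right_minus_eq zero_neq_numeral)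
  then show ?thesis by (simp add: r_def)
qed

section \<open>Vertices as roots of a cubic\<close>

text \<open>The two symmetric-function equations say that \<open>u, v, w\<close> are the roots of
  \<open>z\<^sup>3 + k s z\<^sup>2 - k z - s\<close> with \<open>s = u v w\<close>.\<close>

definition orbit_triple :: "real \<Rightarrow> complex \<Rightarrow> complex \<Rightarrow> complex \<Rightarrow> bool" where
  "orbit_triple k u v w \<longleftrightarrow>
     cmod u = 1 \<and> cmod v = 1 \<and> cmod w = 1 \<and> u \<noteq> v \<and> v \<noteq> w \<and> w \<noteq> u \<and>
     u + v + w = - of_real k * (u * v * w) \<and> u * v + v * w + w * u = - of_real k"

lemma orbit_triple_rotate: "orbit_triple k u v w \<Longrightarrow> orbit_triple k v w u"
  by (auto simp: orbit_triple_def algebra_simps)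

text \<open>The two symmetric-function equations give u + v and w^2 in terms of uv; eliminating
  \<open>w\<close> leaves (u + v)^2 = (k + uv)(1 + k uv).\<close>

lemma orbit_triple_chord:
  assumes "orbit_triple k u v w"
  shows "Re (u * cnj v) - k * Re (u * v) = (k\<^sup>2 - 1) / 2"
proof -
  have u: "cmod u = 1" and v: "cmod v = 1"
    and s: "u + v + w = - of_real k * (u * v * w)" "u * v + v * w + w * u = - of_real k"
    using assms by (auto simp: orbit_triple_def)
  have "u + v = - (w * (1 + of_real k * u * v))" using s(1) by algebra
  moreover have "w\<^sup>2 * (1 + of_real k * u * v) = of_real k + u * v"
    using s by algebra
  ultimately have "(u + v)\<^sup>2 = (of_real k + u * v) * (1 + of_real k * u * v)"
    by algebra
  then have "u\<^sup>2 + v\<^sup>2 - of_real k * (u\<^sup>2 * v\<^sup>2 + 1) = 2 * of_real ((k\<^sup>2 - 1) / 2) * (u * v)"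
    by simp algebra
  then show ?thesis using unit_chord_relation_iff[OF u v] by blast
qed

text \<open>For fixed \<open>u\<close>, the relation is a quadratic equation with the two distinct
  roots \<open>v\<close> and \<open>w\<close>. Its Vieta formulas, compared with those for fixed
  \<open>v\<close>, give the sum of the triple; the second conclusion is the closing
  condition.\<close>

lemma chord_relations_imp_orbit_triple:
  assumes u: "cmod u = 1" and v: "cmod v = 1" and w: "cmod w = 1"
    and d: "u \<noteq> v" "v \<noteq> w" "w \<noteq> u"
    and uv: "Re (u * cnj v) - k * Re (u * v) = g"
    and vw: "Re (v * cnj w) - k * Re (v * w) = g"
    and wu: "Re (w * cnj u) - k * Re (w * u) = g"
  shows "orbit_triple k u v w" "k\<^sup>2 - 1 = 2 * g"
proof -
  define K G where "K = complex_of_real k" and "G = complex_of_real g"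
  have uv: "u\<^sup>2 + v\<^sup>2 - K * (u\<^sup>2 * v\<^sup>2 + 1) = 2 * G * (u * v)"
    using unit_chord_relation_iff[OF u v] uv by (simp add: K_def G_def)
  have vw: "v\<^sup>2 + w\<^sup>2 - K * (v\<^sup>2 * w\<^sup>2 + 1) = 2 * G * (v * w)"
    using unit_chord_relation_iff[OF v w] vw by (simp add: K_def G_def)
  have wu: "w\<^sup>2 + u\<^sup>2 - K * (w\<^sup>2 * u\<^sup>2 + 1) = 2 * G * (w * u)"
    using unit_chord_relation_iff[OF w u] wu by (simp add: K_def G_def)
  \<comment> \<open>Subtracting the relations for (u, v) and (u, w) gives the Vieta formula for the
    sum of the roots; \<open>B\<close> below is the one for their product.\<close>
  have "(v - w) * ((v + w) * (1 - K * u\<^sup>2) - 2 * G * u) = 0" using uv wu by algebra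
  then have A: "(v + w) * (1 - K * u\<^sup>2) = 2 * G * u" using d by simp
  have "(w - u) * ((w + u) * (1 - K * v\<^sup>2) - 2 * G * v) = 0" using uv vw by algebra
  then have A': "(w + u) * (1 - K * v\<^sup>2) = 2 * G * v" using d by simp
  have B: "(1 - K * u\<^sup>2) * v * w = u\<^sup>2 - K" using A uv by algebra
  have B': "(1 - K * v\<^sup>2) * w * u = v\<^sup>2 - K" using A' vw by algebra
  have "(u - v) * (u + v + w + K * (u * v * w)) = 0" using B B' by algebra
  then have s1: "u + v + w = - K * (u * v * w)" using d by (simp add: eq_neg_iff_add_eq_0)
  \<comment> \<open>On the unit circle, conjugating the equation for the sum and multiplying by
    \<open>u * v * w\<close> gives the one for the pairwise products.\<close>
  then have "cnj (u + v + w) = cnj (- K * (u * v * w))" by simp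
  then have "cnj u + cnj v + cnj w = - K * (cnj u * cnj v * cnj w)" by (simp add: K_def)
  then have s2: "u * v + v * w + w * u = - K"
    using unit_mult_cnj[OF u] unit_mult_cnj[OF v] unit_mult_cnj[OF w] by algebra
  show "orbit_triple k u v w"
    using u v w d s1 s2 by (simp add: orbit_triple_def K_def)
  have "u * (K\<^sup>2 - 1 - 2 * G) = 0" using A s1 s2 by algebra
  then have "K\<^sup>2 - 1 = 2 * G" using u by auto
  then have "complex_of_real (k\<^sup>2 - 1) = of_real (2 * g)" by (simp add: K_def G_def)
  then show "k\<^sup>2 - 1 = 2 * g" by (simp only: of_real_eq_iff)
qed

section \<open>Existence of a triple with prescribed product\<close>

text \<open>The equation forces the Blaschke product z (z^2 - k) / (1 - k z^2) to have modulus 1.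
  Comparing squared moduli, with r = |z|^2, produces r - 1 times a positive factor.\<close>

lemma cmod_root_eq_1:
  assumes s: "cmod s = 1" and k: "0 < k" "k < 1"
    and z: "z ^ 3 + of_real k * s * z\<^sup>2 - of_real k * z - s = 0"
  shows "cmod z = 1"
proof -
  define A where "A = (cmod (z\<^sup>2 - of_real k))\<^sup>2"
  define r where "r = (cmod z)\<^sup>2"
  have "z * (z\<^sup>2 - of_real k) = s * (1 - of_real k * z\<^sup>2)" using z by algebra
  then have "cmod z * cmod (z\<^sup>2 - of_real k) = cmod (1 - of_real k * z\<^sup>2)"
    by (metis norm_mult s mult_1)
  then have "r * A = (cmod (1 - of_real k * z\<^sup>2))\<^sup>2"
    unfolding r_def A_def by (metis power_mult_distrib)
  also have "\<dots> = A + (1 - k\<^sup>2) * (1 - r\<^sup>2)"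
  proof -
    have "(cmod (z\<^sup>2))\<^sup>2 = r\<^sup>2" by (simp add: r_def norm_power)
    then have "(Re (z\<^sup>2))\<^sup>2 + (Im (z\<^sup>2))\<^sup>2 = r\<^sup>2" by (simp only: cmod_power2)
    then show ?thesis unfolding A_def cmod_power2 by simp algebra
  qed
  finally have "(r - 1) * (A + (1 - k\<^sup>2) * (1 + r)) = 0" by algebra
  moreover have "A + (1 - k\<^sup>2) * (1 + r) > 0"
  proof (rule add_nonneg_pos[OF _ mult_pos_pos])
    show "0 < 1 - k\<^sup>2" using k by (simp add: power_less_one_iff)
    show "0 < 1 + r" unfolding r_def by (intro add_pos_nonneg) auto
  qed (simp add: A_def)
  ultimately have "r = 1" by auto
  then show ?thesis by (simp add: r_def power2_eq_1_iff) (metis norm_ge_zero not_one_le_zero neg_0_le_iff_le)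
qed

text \<open>A double root \<open>u\<close> would give |u + 2w| = k < 1, whereas this modulus is at
  least 2 - 1.\<close>

lemma double_root_False:
  assumes "cmod u = 1" "cmod w = 1" and k: "0 < k" "k < 1"
    and "u * u + u * w + w * u = - of_real k"
  shows False
proof -
  have "u * (u + 2 * w) = - of_real k" using assms(5) by algebra
  then have "cmod (u * (u + 2 * w)) = k" using k by simp
  then have "cmod (u + 2 * w) = k" using assms by (simp add: norm_mult)
  moreover have "cmod (2 * w) \<le> cmod (u + 2 * w) + cmod u"
    by (metis add_diff_cancel_left' norm_triangle_ineq4)
  ultimately show False using assms by (simp add: norm_mult)
qed

text \<open>One root of the cubic comes from the fundamental theorem of algebra, the other two from
  the quadratic formula. They lie on the unit circle and are distinct by the two preceding
  lemmas.\<close>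

lemma ex_orbit_triple:
  assumes s: "cmod s = 1" and k: "0 < k" "k < 1"
  obtains u v w where "orbit_triple k u v w" "u * v * w = s"
proof -
  define K where "K = complex_of_real k"
  have "\<not> constant (poly [:- s, - K, K * s, 1:])" by (simp add: constant_degree)
  then obtain u where "poly [:- s, - K, K * s, 1:] u = 0"
    using fundamental_theorem_of_algebra by blast
  then have u: "u ^ 3 + K * s * u\<^sup>2 - K * u - s = 0"
    by (simp add: algebra_simps power2_eq_square power3_eq_cube)
  \<comment> \<open>Dividing the cubic by z - u leaves the quotient z^2 + B z + C.\<close>
  define B C where "B = K * s + u" and "C = u * B - K"
  define q where "q = csqrt (B\<^sup>2 - 4 * C)"
  define v w where "v = (- B + q) / 2" and "w = (- B - q) / 2"
  have q: "q\<^sup>2 = B\<^sup>2 - 4 * C" by (simp add: q_def)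
  have sum: "v + w = - B" by (simp add: v_def w_def field_simps)
  have "v * w = (B\<^sup>2 - q\<^sup>2) / 4" by (simp add: v_def w_def field_simps power2_eq_square)
  then have prod: "v * w = C" by (simp add: q)
  have e1: "u + v + w = - K * s" using sum unfolding B_def by algebra
  have e2: "u * v + v * w + w * u = - K" using sum prod unfolding C_def by algebra
  have e3: "u * v * w = s" using prod u unfolding C_def B_def by algebra
  have v: "v ^ 3 + K * s * v\<^sup>2 - K * v - s = 0" using e1 e2 e3 by algebra
  have w: "w ^ 3 + K * s * w\<^sup>2 - K * w - s = 0" using e1 e2 e3 by algebra
  have unit: "cmod u = 1" "cmod v = 1" "cmod w = 1"
    using u v w cmod_root_eq_1[OF s k] by (auto simp: K_def)
  have "u \<noteq> v" using double_root_False[OF unit(1,3) k] e2 by (auto simp: K_def)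
  moreover have "v \<noteq> w"
    using double_root_False[OF unit(2,1) k] e2 by (auto simp: K_def algebra_simps)
  moreover have "w \<noteq> u"
    using double_root_False[OF unit(1,2) k] e2 by (auto simp: K_def algebra_simps)
  ultimately have "orbit_triple k u v w"
    using unit e1 e2 e3 by (simp add: orbit_triple_def K_def)
  then show thesis using e3 that by blast
qed

text \<open>The second equation is the cubic at its root \<open>u\<close>, divided by
  \<open>u\<close>, with \<open>cnj u\<close> for the inverse.\<close>

lemma orbit_triple_product:
  assumes "orbit_triple k u v w"
  shows "cmod (u * v * w) = 1"
    "u\<^sup>2 + of_real k * (u * v * w) * u - (u * v * w) * cnj u = of_real k"
proof -
  have n: "cmod u = 1" "cmod v = 1" "cmod w = 1"
    and s: "u + v + w = - of_real k * (u * v * w)" "u * v + v * w + w * u = - of_real k"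
    using assms by (auto simp: orbit_triple_def)
  show "cmod (u * v * w) = 1" using n by (simp add: norm_mult)
  show "u\<^sup>2 + of_real k * (u * v * w) * u - (u * v * w) * cnj u = of_real k"
    using s unit_mult_cnj[OF n(1)] by algebra
qed

section \<open>3-periodics are exactly the orbit triples\<close>

text \<open>The equation is the condition for the relation with parameter \<open>k\<close> to close up after three
  steps.\<close>

locale elliptic_billiard =
  fixes a b k :: real
  assumes b_pos: "0 < b" and b_less_a: "b < a" and k_pos: "0 < k" and k_less_1: "k < 1"
    and k_eq: "k\<^sup>2 * (a\<^sup>2 - b\<^sup>2) + 2 * k * (a\<^sup>2 + b\<^sup>2) = 3 * (a\<^sup>2 - b\<^sup>2)"
begin

lemma a_pos: "0 < a" using b_pos b_less_a by linarith

lemma c2_pos: "0 < a\<^sup>2 - b\<^sup>2"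
  using b_pos b_less_a by (simp add: power_strict_mono)

text \<open>Joachimsthal's constant.\<close>

definition J where "J = sqrt (k / (a\<^sup>2 - b\<^sup>2))"

lemma J_pos: "0 < J" using k_pos c2_pos by (simp add: J_def)

lemma J_sq: "J\<^sup>2 * (a\<^sup>2 - b\<^sup>2) = k" "1 - J\<^sup>2 * (a\<^sup>2 + b\<^sup>2) = (k\<^sup>2 - 1) / 2"
proof -
  have J: "J\<^sup>2 = k / (a\<^sup>2 - b\<^sup>2)" using k_pos c2_pos by (simp add: J_def)
  show "J\<^sup>2 * (a\<^sup>2 - b\<^sup>2) = k" using c2_pos by (simp add: J)
  show "1 - J\<^sup>2 * (a\<^sup>2 + b\<^sup>2) = (k\<^sup>2 - 1) / 2"
    using c2_pos k_eq by (simp add: J field_simps)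
qed

text \<open>This removes the square roots from the side lengths: scaled by \<open>J\<close>, they
  become polynomial in the vertices and their conjugates.\<close>

lemma dist_orbit_triple:
  assumes "orbit_triple k u v w"
  shows "dist (ellipse_pt a b u) (ellipse_pt a b v) = (1 - Re (u * cnj v)) / J"
proof -
  have "1 - Re (u * cnj v) = J * dist (ellipse_pt a b u) (ellipse_pt a b v)"
    using assms orbit_triple_chord[OF assms]
    by (subst Joachimsthal_iff) (auto simp: J_pos a_pos b_pos J_sq orbit_triple_def)
  then show ?thesis using J_pos by (simp add: field_simps)
qed

text \<open>The bisector conditions give one common ratio \<open>I\<close> on all three sides, hence
  three chord relations with the same coefficients. Their closing condition determines
  \<open>I\<close>.\<close>

lemma three_periodic_imp_orbit_triple:
  assumes "three_periodic a b P1 P2 P3"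
  obtains u v w where "orbit_triple k u v w"
    "P1 = ellipse_pt a b u" "P2 = ellipse_pt a b v" "P3 = ellipse_pt a b w"
proof -
  obtain u v w where u: "cmod u = 1" "P1 = ellipse_pt a b u"
    and v: "cmod v = 1" "P2 = ellipse_pt a b v" and w: "cmod w = 1" "P3 = ellipse_pt a b w"
    using assms by (auto simp: three_periodic_def on_ellipse_iff a_pos b_pos)
  have d: "u \<noteq> v" "v \<noteq> w" "w \<noteq> u"
    using assms nondegenerate_ellipse_pt_iff[of a b u v w] a_pos b_pos u v w
    by (auto simp: three_periodic_def)
  define D where "D = (\<lambda>x y. dist (ellipse_pt a b x) (ellipse_pt a b y))"
  define I where "I = (1 - Re (u * cnj v)) / D u v"
  have ne: "D x y > 0" if "x \<noteq> y" for x y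
    using that a_pos b_pos by (simp add: D_def ellipse_pt_inj)
  have I: "0 < I" unfolding I_def
    using Re_mult_cnj_less_1[OF u(1) v(1)] ne d by (intro divide_pos_pos) auto
  have sym: "D x y = D y x" "Re (x * cnj y) = Re (y * cnj x)" for x y
    by (simp_all add: D_def dist_commute algebra_simps)
  have "normal_bisects a b P1 P2 P3" "normal_bisects a b P2 P3 P1"
    using assms by (auto simp: three_periodic_def)
  then have "(1 - Re (w * cnj u)) / D w u = I" "(1 - Re (v * cnj w)) / D v w = I"
    using normal_bisects_ellipse_pt_iff[OF a_pos b_pos u(1) v(1) w(1) d]
      normal_bisects_ellipse_pt_iff[OF a_pos b_pos v(1) w(1) u(1) d(2) d(3) d(1)]
      sym[of w u] sym[of v u]
    by (simp_all add: u v w D_def I_def mult.commute)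
  moreover have "(1 - Re (u * cnj v)) / D u v = I" by (simp add: I_def)
  moreover have "D u v \<noteq> 0" "D v w \<noteq> 0" "D w u \<noteq> 0"
    using ne d by (metis less_irrefl)+
  ultimately have "1 - Re (u * cnj v) = I * D u v" "1 - Re (v * cnj w) = I * D v w"
    "1 - Re (w * cnj u) = I * D w u"
    by (metis nonzero_divide_eq_eq)+
  then have r: "Re (u * cnj v) - I\<^sup>2 * (a\<^sup>2 - b\<^sup>2) * Re (u * v) = 1 - I\<^sup>2 * (a\<^sup>2 + b\<^sup>2)"
    "Re (v * cnj w) - I\<^sup>2 * (a\<^sup>2 - b\<^sup>2) * Re (v * w) = 1 - I\<^sup>2 * (a\<^sup>2 + b\<^sup>2)"
    "Re (w * cnj u) - I\<^sup>2 * (a\<^sup>2 - b\<^sup>2) * Re (w * u) = 1 - I\<^sup>2 * (a\<^sup>2 + b\<^sup>2)"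
    using Joachimsthal_iff[OF I a_pos b_pos] u v w d by (simp_all add: D_def)
  note * = chord_relations_imp_orbit_triple[OF u(1) v(1) w(1) d r]
  define l where "l = I\<^sup>2 * (a\<^sup>2 - b\<^sup>2)"
  have l: "0 < l" using I c2_pos by (simp add: l_def)
  have "l\<^sup>2 * (a\<^sup>2 - b\<^sup>2) + 2 * l * (a\<^sup>2 + b\<^sup>2) = 3 * (a\<^sup>2 - b\<^sup>2)"
    using *(2) unfolding l_def by algebra
  \<comment> \<open>\<open>l\<close> and \<open>k\<close> satisfy the same quadratic equation, which
    has only one positive root.\<close>
  with k_eq have "(l - k) * ((l + k) * (a\<^sup>2 - b\<^sup>2) + 2 * (a\<^sup>2 + b\<^sup>2)) = 0"
    by algebra
  moreover have "(l + k) * (a\<^sup>2 - b\<^sup>2) + 2 * (a\<^sup>2 + b\<^sup>2) > 0"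
    using l k_pos c2_pos a_pos b_pos by (intro add_pos_pos mult_pos_pos) auto
  ultimately have "l = k" by auto
  then show thesis using that *(1) u v w by (simp add: l_def)
qed

text \<open>The ratio of \<open>1 - Re (x * cnj y)\<close> to the side length is \<open>J\<close> on
  both sides at a vertex; cyclic symmetry carries the argument from one vertex to the
  others.\<close>

lemma orbit_triple_imp_three_periodic:
  assumes "orbit_triple k u v w"
  shows "three_periodic a b (ellipse_pt a b u) (ellipse_pt a b v) (ellipse_pt a b w)"
proof -
  have bis: "normal_bisects a b (ellipse_pt a b x) (ellipse_pt a b y) (ellipse_pt a b z)"
    if t: "orbit_triple k x y z" for x y z
  proof -
    have n: "cmod x = 1" "cmod y = 1" "cmod z = 1" "x \<noteq> y" "y \<noteq> z" "z \<noteq> x"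
      using t by (auto simp: orbit_triple_def)
    have "(1 - Re (x * cnj y)) / dist (ellipse_pt a b x) (ellipse_pt a b y) = J"
      using dist_orbit_triple[OF t] Re_mult_cnj_less_1[OF n(1) n(2)] n(4) by simp
    moreover have "(1 - Re (x * cnj z)) / dist (ellipse_pt a b x) (ellipse_pt a b z) = J"
      using dist_orbit_triple[OF orbit_triple_rotate[OF orbit_triple_rotate[OF t]]]
         Re_mult_cnj_less_1[OF n(1) n(3)] n(6)
      by (simp add: dist_commute mult.commute)
    ultimately show ?thesis
      using normal_bisects_ellipse_pt_iff[OF a_pos b_pos n] by simp
  qed
  have "nondegenerate (ellipse_pt a b u) (ellipse_pt a b v) (ellipse_pt a b w)"
    using assms a_pos b_pos by (subst nondegenerate_ellipse_pt_iff) (auto simp: orbit_triple_def)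
  moreover have "normal_bisects a b (ellipse_pt a b u) (ellipse_pt a b v) (ellipse_pt a b w)"
     "normal_bisects a b (ellipse_pt a b v) (ellipse_pt a b w) (ellipse_pt a b u)"
     "normal_bisects a b (ellipse_pt a b w) (ellipse_pt a b u) (ellipse_pt a b v)"
    by (intro bis assms orbit_triple_rotate[OF assms] orbit_triple_rotate[OF orbit_triple_rotate[OF assms]])+
  ultimately show ?thesis
    using assms by (auto simp: three_periodic_def on_ellipse_iff a_pos b_pos orbit_triple_def)
qed

end

section \<open>The orthocenter as a triangle center\<close>

text \<open>This division-free description of the orthocenter keeps its meaning at a right angle,
  where the trilinears of \<open>h_X4\<close> are undefined.\<close>

definition altitudes_meet :: "pt \<Rightarrow> pt \<Rightarrow> pt \<Rightarrow> pt \<Rightarrow> bool" where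
  "altitudes_meet P Q R X \<longleftrightarrow>
     inner (X - P) (Q - R) = 0 \<and> inner (X - Q) (R - P) = 0 \<and> inner (X - R) (P - Q) = 0"

text \<open>The legs are themselves altitudes and meet at the right-angled vertex. This locates the
  positions missing from the locus.\<close>

lemma altitudes_meet_right_angle:
  assumes "nondegenerate P Q R" "altitudes_meet P Q R X" "inner (Q - P) (R - P) = 0"
  shows "X = P"
proof -
  obtain p1 p2 q1 q2 r1 r2 x y where e: "P = (p1,p2)" "Q = (q1,q2)" "R = (r1,r2)" "X = (x,y)"
    by (metis surj_pair)
  define K where "K = (q1 - p1) * (r2 - p2) - (q2 - p2) * (r1 - p1)"
  have K: "K \<noteq> 0" using assms(1) by (simp add: nondegenerate_def cross2_def e K_def)
  have 1: "(x - p1) * (q1 - r1) + (y - p2) * (q2 - r2) = 0"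
    "(x - q1) * (r1 - p1) + (y - q2) * (r2 - p2) = 0"
    "(q1 - p1) * (r1 - p1) + (q2 - p2) * (r2 - p2) = 0"
    using assms by (auto simp: altitudes_meet_def e)
  have "K * (x - p1) = 0" "K * (y - p2) = 0" using 1 unfolding K_def by algebra+
  then show ?thesis using K by (simp add: e)
qed

text \<open>Heron's formula in Conway's notation: the squared sides at \<open>P\<close> are d + e
  and d + f, and (d + e)(d + f) - d^2 is the squared cross product.\<close>

lemma cross2_sq_eq_inner:
  fixes P Q R :: pt
  assumes "inner (Q - P) (R - P) = d" "inner (R - Q) (P - Q) = e" "inner (P - R) (Q - R) = f"
  shows "(cross2 (Q - P) (R - P))\<^sup>2 = e * f + f * d + d * e"
proof -
  obtain p1 p2 q1 q2 r1 r2 where c: "P = (p1,p2)" "Q = (q1,q2)" "R = (r1,r2)"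
    by (metis surj_pair)
  have d: "d = (q1 - p1) * (r1 - p1) + (q2 - p2) * (r2 - p2)"
    and e: "e = (r1 - q1) * (p1 - q1) + (r2 - q2) * (p2 - q2)"
    and f: "f = (p1 - r1) * (q1 - r1) + (p2 - r2) * (q2 - r2)"
    using assms by (auto simp: c)
  have "cross2 (Q - P) (R - P) = (q1 - p1) * (r2 - p2) - (q2 - p2) * (r1 - p1)"
    by (simp add: c cross2_def)
  then show ?thesis unfolding d e f by algebra
qed

text \<open>These are the barycentric coordinates 1/d : 1/e : 1/f cleared of denominators. Solving
  two altitude equations by Cramer's rule, with determinant \<open>K\<close>, gives
  \<open>X - P\<close> as \<open>d / K\<close> times the opposite side turned by a right
  angle.\<close>

lemma orthocenter_barycentric:
  assumes nd: "nondegenerate P Q R" and X: "altitudes_meet P Q R X"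
    and d: "inner (Q - P) (R - P) = d" and e: "inner (R - Q) (P - Q) = e"
    and f: "inner (P - R) (Q - R) = f"
  shows "(e * f + f * d + d * e) *\<^sub>R X = (e * f) *\<^sub>R P + (f * d) *\<^sub>R Q + (d * e) *\<^sub>R R"
proof -
  obtain p1 p2 q1 q2 r1 r2 x y where c: "P = (p1,p2)" "Q = (q1,q2)" "R = (r1,r2)" "X = (x,y)"
    by (metis surj_pair)
  define K where "K = (q1 - p1) * (r2 - p2) - (q2 - p2) * (r1 - p1)"
  have K2: "e * f + f * d + d * e = K\<^sup>2"
    using cross2_sq_eq_inner[OF d e f] by (simp add: K_def c cross2_def)
  have 1: "(x - p1) * (q1 - r1) + (y - p2) * (q2 - r2) = 0"
    "(x - q1) * (r1 - p1) + (y - q2) * (r2 - p2) = 0"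
    using X by (auto simp: altitudes_meet_def c)
  have d: "d = (q1 - p1) * (r1 - p1) + (q2 - p2) * (r2 - p2)"
    and e: "e = (r1 - q1) * (p1 - q1) + (r2 - q2) * (p2 - q2)"
    and f: "f = (p1 - r1) * (q1 - r1) + (p2 - r2) * (q2 - r2)"
    using d e f by (auto simp: c)
  have x: "K * (x - p1) = (r2 - q2) * d" and y: "K * (y - p2) = (q1 - r1) * d"
    using 1 unfolding K_def d by algebra+
  have "K\<^sup>2 * (x - p1) = K * ((r2 - q2) * d)" using x by algebra
  also have "\<dots> = (e * f) * p1 + (f * d) * q1 + (d * e) * r1 - K\<^sup>2 * p1"
    unfolding K2[symmetric] unfolding d e f K_def by algebra
  finally have X: "K\<^sup>2 * x = (e * f) * p1 + (f * d) * q1 + (d * e) * r1" by algebra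
  have "K\<^sup>2 * (y - p2) = K * ((q1 - r1) * d)" using y by algebra
  also have "\<dots> = (e * f) * p2 + (f * d) * q2 + (d * e) * r2 - K\<^sup>2 * p2"
    unfolding K2[symmetric] unfolding d e f K_def by algebra
  finally have Y: "K\<^sup>2 * y = (e * f) * p2 + (f * d) * q2 + (d * e) * r2" by algebra
  show ?thesis unfolding K2 using X Y by (simp add: c)
qed

lemma law_of_cosines:
  fixes P Q R :: pt
  shows "(dist R P)\<^sup>2 + (dist P Q)\<^sup>2 - (dist Q R)\<^sup>2 = 2 * inner (Q - P) (R - P)"
  by (simp add: dist_norm power2_norm_eq_inner inner_diff_left inner_diff_right inner_commute)

text \<open>By the law of cosines the weights are 1/(2d), 1/(2e), 1/(2f). Their sum is the squared
  cross product over 2def, so only a right angle can make the center undefined.\<close>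

lemma center_X4:
  assumes nd: "nondegenerate P Q R"
  shows "center_defined h_X4 P Q R \<longleftrightarrow>
      inner (Q - P) (R - P) \<noteq> 0 \<and> inner (R - Q) (P - Q) \<noteq> 0 \<and> inner (P - R) (Q - R) \<noteq> 0"
      (is ?A)
    and "\<lbrakk>center_defined h_X4 P Q R; altitudes_meet P Q R X\<rbrakk> \<Longrightarrow> center h_X4 P Q R = X"
proof -
  define d e f where "d = inner (Q - P) (R - P)" and "e = inner (R - Q) (P - Q)"
    and "f = inner (P - R) (Q - R)"
  note def = d_def e_def f_def
  have ne: "Q \<noteq> R" "R \<noteq> P" "P \<noteq> Q"
    using nd by (auto simp: nondegenerate_def cross2_def)
  have cos: "(dist R P)\<^sup>2 + (dist P Q)\<^sup>2 - (dist Q R)\<^sup>2 = 2 * d"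
    "(dist P Q)\<^sup>2 + (dist Q R)\<^sup>2 - (dist R P)\<^sup>2 = 2 * e"
    "(dist Q R)\<^sup>2 + (dist R P)\<^sup>2 - (dist P Q)\<^sup>2 = 2 * f"
    unfolding def by (rule law_of_cosines)+
  have none: "h_X4 (dist Q R) (dist R P) (dist P Q) = (if d = 0 then None else Some (1 / (dist Q R * (2 * d))))"
    "h_X4 (dist R P) (dist P Q) (dist Q R) = (if e = 0 then None else Some (1 / (dist R P * (2 * e))))"
    "h_X4 (dist P Q) (dist Q R) (dist R P) = (if f = 0 then None else Some (1 / (dist P Q * (2 * f))))"
    unfolding h_X4_def cos using ne by simp_all
  define T where "T = e * f + f * d + d * e"
  have Tne: "T \<noteq> 0"
    using nd cross2_sq_eq_inner[OF def[symmetric]] by (auto simp: nondegenerate_def T_def[symmetric])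
  have Teq: "1 / (dist Q R * (2 * d)) * dist Q R + 1 / (dist R P * (2 * e)) * dist R P
       + 1 / (dist P Q * (2 * f)) * dist P Q = T / (2 * d * e * f)"
    if "d \<noteq> 0" "e \<noteq> 0" "f \<noteq> 0"
    using ne that by (simp add: T_def field_simps)
  show A: ?A
    unfolding center_defined_def Let_def none def[symmetric] using Teq Tne by auto
  assume "center_defined h_X4 P Q R" and X: "altitudes_meet P Q R X"
  with A have nz: "d \<noteq> 0" "e \<noteq> 0" "f \<noteq> 0" by (auto simp: def)
  have "T *\<^sub>R X = (e * f) *\<^sub>R P + (f * d) *\<^sub>R Q + (d * e) *\<^sub>R R"
    unfolding T_def using orthocenter_barycentric[OF nd X] by (simp add: def)
  then have "(1 / T) *\<^sub>R (T *\<^sub>R X) = (1 / T) *\<^sub>R ((e * f) *\<^sub>R P + (f * d) *\<^sub>R Q + (d * e) *\<^sub>R R)"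
    by simp
  then have X: "X = (1 / T) *\<^sub>R ((e * f) *\<^sub>R P + (f * d) *\<^sub>R Q + (d * e) *\<^sub>R R)"
    using Tne by simp
  have "center h_X4 P Q R = (1 / (T / (2 * d * e * f))) *\<^sub>R
      ((1 / (2 * d)) *\<^sub>R P + (1 / (2 * e)) *\<^sub>R Q + (1 / (2 * f)) *\<^sub>R R)"
    unfolding center_def Let_def none using nz ne Teq[OF nz] by simp
  also have "\<dots> = X"
    unfolding X scaleR_add_right scaleR_scaleR using nz Tne by (simp add: field_simps)
  finally show "center h_X4 P Q R = X" .
qed

section \<open>The loci\<close>

lemma locus_I:
  "\<lbrakk>three_periodic a b P Q R; center_defined h P Q R\<rbrakk> \<Longrightarrow> center h P Q R \<in> locus a b h"
  unfolding locus_def by blast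

context elliptic_billiard
begin

text \<open>The constants of the theorem with \<open>\<delta>\<close> eliminated in favour of \<open>k\<close>.\<close>

definition k4 where "k4 = (k * (a\<^sup>2 + b\<^sup>2) + (a\<^sup>2 - b\<^sup>2)) / 2"
definition k10 where "k10 = (k * (a\<^sup>2 + b\<^sup>2) - (a\<^sup>2 - b\<^sup>2)) / 4"

lemma k4_pos: "0 < k4"
  using k_pos c2_pos a_pos b_pos by (auto simp: k4_def intro!: add_pos_pos mult_pos_pos)

lemma k10_pos: "0 < k10"
proof -
  have "8 * k10 = (a\<^sup>2 - b\<^sup>2) * (1 - k\<^sup>2)" using k_eq unfolding k10_def by (simp add: field_simps)
  moreover have "0 < (a\<^sup>2 - b\<^sup>2) * (1 - k\<^sup>2)"
    using c2_pos k_pos k_less_1 by (simp add: power_less_one_iff)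
  ultimately show ?thesis by simp
qed

definition X4_pt where "X4_pt s = (- (k4 / a) * Re s, - (k4 / b) * Im s)"
definition X10_pt where "X10_pt s = (- (k10 / a) * Re s, - (k10 / b) * Im s)"

lemma nondegenerate_orbit_triple:
  "orbit_triple k u v w \<Longrightarrow> nondegenerate (ellipse_pt a b u) (ellipse_pt a b v) (ellipse_pt a b w)"
  using orbit_triple_imp_three_periodic by (auto simp: three_periodic_def)

text \<open>Taking real parts in the cubic divided by its root, and subtracting for \<open>v\<close>
  and \<open>w\<close>, makes the difference of \<open>(Re v)\<^sup>2\<close> and
  \<open>(Re w)\<^sup>2\<close> linear in the coordinate differences. With \<open>u\<close>
  eliminated through the sum, both coordinates then carry the coefficient \<open>k4\<close>.\<close>

lemma altitude_orbit_triple: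
  assumes "orbit_triple k u v w"
  shows "inner (X4_pt (u * v * w) - ellipse_pt a b u) (ellipse_pt a b v - ellipse_pt a b w) = 0"
proof -
  define s where "s = u * v * w"
  have n: "cmod v = 1" "cmod w = 1"
    and sum: "u + v + w = - of_real k * s"
    using assms by (auto simp: orbit_triple_def s_def)
  have root: "(1 - k) * Re s * Re z + (1 + k) * Im s * Im z = 2 * (Re z)\<^sup>2 - 1 - k"
    if "orbit_triple k z z' z''" "z * z' * z'' = s" for z z' z''
  proof -
    have "Re (z\<^sup>2 + of_real k * s * z - s * cnj z) = k"
      using orbit_triple_product(2)[OF that(1)] by (simp add: that(2))
    then have "(Re z)\<^sup>2 - (Im z)\<^sup>2 + k * (Re s * Re z - Im s * Im z) - (Re s * Re z + Im s * Im z) = k"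
      by (simp add: power2_eq_square algebra_simps)
    moreover have "(Re z)\<^sup>2 + (Im z)\<^sup>2 = 1" using that unit_sq by (auto simp: orbit_triple_def)
    ultimately show ?thesis by (simp add: algebra_simps)
  qed
  note rv = root[OF orbit_triple_rotate[OF assms]]
  note rw = root[OF orbit_triple_rotate[OF orbit_triple_rotate[OF assms]]]
  have R: "(1 - k) * Re s * Re v + (1 + k) * Im s * Im v = 2 * (Re v)\<^sup>2 - 1 - k"
    "(1 - k) * Re s * Re w + (1 + k) * Im s * Im w = 2 * (Re w)\<^sup>2 - 1 - k"
    using rv rw by (simp_all add: s_def mult_ac)
  have x: "Re u = - k * Re s - Re v - Re w" "Im u = - k * Im s - Im v - Im w"
    using arg_cong[OF sum, of Re] arg_cong[OF sum, of Im] by simp_all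
  have "inner (X4_pt s - ellipse_pt a b u) (ellipse_pt a b v - ellipse_pt a b w)
     = - k4 * (Re s * (Re v - Re w) + Im s * (Im v - Im w))
       - a\<^sup>2 * Re u * (Re v - Re w) - b\<^sup>2 * Im u * (Im v - Im w)"
    using a_pos b_pos by (simp add: X4_pt_def ellipse_pt_def field_simps power2_eq_square)
  also have "\<dots> = 0"
  proof -
    have 2: "2 * k4 = k * (a\<^sup>2 + b\<^sup>2) + (a\<^sup>2 - b\<^sup>2)" by (simp add: k4_def)
    have 3: "(Re v)\<^sup>2 + (Im v)\<^sup>2 = (Re w)\<^sup>2 + (Im w)\<^sup>2"
      using unit_sq[OF n(1)] unit_sq[OF n(2)] by simp
    have "2 * ((Re v)\<^sup>2 - (Re w)\<^sup>2) = (1 - k) * Re s * (Re v - Re w) + (1 + k) * Im s * (Im v - Im w)"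
      using R by (simp add: algebra_simps)
    then have "2 * (- k4 * (Re s * (Re v - Re w) + Im s * (Im v - Im w))
       - a\<^sup>2 * Re u * (Re v - Re w) - b\<^sup>2 * Im u * (Im v - Im w)) = 0"
      unfolding x using 2 3 by algebra
    then show ?thesis by simp
  qed
  finally show ?thesis by (simp add: s_def)
qed

lemma altitudes_meet_orbit_triple:
  assumes "orbit_triple k u v w"
  shows "altitudes_meet (ellipse_pt a b u) (ellipse_pt a b v) (ellipse_pt a b w) (X4_pt (u * v * w))"
  using altitude_orbit_triple[OF assms] altitude_orbit_triple[OF orbit_triple_rotate[OF assms]]
    altitude_orbit_triple[OF orbit_triple_rotate[OF orbit_triple_rotate[OF assms]]]
  by (simp add: altitudes_meet_def mult_ac)

lemma rotated_ellipse_parametrization: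
  assumes "c > 0"
  shows "X \<in> ellipse_set (c / a) (c / b) \<longleftrightarrow>
    (\<exists>s. cmod s = 1 \<and> X = (- (c / a) * Re s, - (c / b) * Im s))"
proof
  assume X: "X \<in> ellipse_set (c / a) (c / b)"
  define s where "s = Complex (- (a / c) * fst X) (- (b / c) * snd X)"
  have "cmod s = 1"
    using X by (simp add: s_def ellipse_set_def cmod_def power_divide power_mult_distrib mult.commute)
  moreover have "X = (- (c / a) * Re s, - (c / b) * Im s)"
    using assms a_pos b_pos by (simp add: s_def)
  ultimately show "\<exists>s. cmod s = 1 \<and> X = (- (c / a) * Re s, - (c / b) * Im s)" by blast
next
  assume "\<exists>s. cmod s = 1 \<and> X = (- (c / a) * Re s, - (c / b) * Im s)"
  then show "X \<in> ellipse_set (c / a) (c / b)"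
    using assms a_pos b_pos by (auto simp: ellipse_set_def power_divide power_mult_distrib unit_sq)
qed

section \<open>The Spieker center\<close>

text \<open>Since v w = s / u, the side opposite \<open>u\<close> depends on \<open>u\<close> and
  the product s alone, so sums over the sides become symmetric functions of the roots.\<close>

lemma side_orbit_triple:
  assumes "orbit_triple k u v w"
  shows "J * dist (ellipse_pt a b v) (ellipse_pt a b w) = (3 - k\<^sup>2) / 2 - k * Re (u * v * w * cnj u)"
proof -
  note t = orbit_triple_rotate[OF assms]
  have "J * dist (ellipse_pt a b v) (ellipse_pt a b w) = 1 - Re (v * cnj w)"
    using J_pos by (simp add: dist_orbit_triple[OF t])
  also have "Re (v * cnj w) = (k\<^sup>2 - 1) / 2 + k * Re (v * w)"
    using orbit_triple_chord[OF t] by linarith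
  also have "v * w = u * v * w * cnj u"
  proof -
    have "u * cnj u = 1" using assms unit_mult_cnj by (auto simp: orbit_triple_def)
    then show ?thesis by algebra
  qed
  finally show ?thesis by (simp add: field_simps)
qed

text \<open>Each barycentric weight is the perimeter minus the opposite side. The perimeter is
  constant over the family, and the side-weighted sum of the vertices reduces to power sums of the
  roots.\<close>

lemma center_X10:
  assumes t: "orbit_triple k u v w"
  shows "center_defined h_X10 (ellipse_pt a b u) (ellipse_pt a b v) (ellipse_pt a b w)"
    "center h_X10 (ellipse_pt a b u) (ellipse_pt a b v) (ellipse_pt a b w) = X10_pt (u * v * w)"
proof -
  define s where "s = u * v * w"
  define P Q R where "P = ellipse_pt a b u" and "Q = ellipse_pt a b v" and "R = ellipse_pt a b w"
  note PQR = P_def Q_def R_def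
  define d e f where "d = dist Q R" and "e = dist R P" and "f = dist P Q"
  have n: "cmod u = 1" "cmod v = 1" "cmod w = 1"
    and ne: "u \<noteq> v" "v \<noteq> w" "w \<noteq> u"
    and sum: "u + v + w = - of_real k * s" and sum2: "u * v + v * w + w * u = - of_real k"
    using t by (auto simp: orbit_triple_def s_def)
  have pos: "d > 0" "e > 0" "f > 0"
    using ne a_pos b_pos by (auto simp: d_def e_def f_def PQR ellipse_pt_inj)
  have t': "orbit_triple k v w u" "orbit_triple k w u v"
    using t orbit_triple_rotate by blast+
  have w: "J * d = (3 - k\<^sup>2) / 2 - k * Re (s * cnj u)"
    "J * e = (3 - k\<^sup>2) / 2 - k * Re (s * cnj v)"
    "J * f = (3 - k\<^sup>2) / 2 - k * Re (s * cnj w)"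
    using side_orbit_triple[OF t] side_orbit_triple[OF t'(1)] side_orbit_triple[OF t'(2)]
    unfolding d_def e_def f_def PQR s_def by (simp_all only: mult_ac)
  have ss: "s * cnj s = 1" unfolding s_def by (rule unit_mult_cnj[OF orbit_triple_product(1)[OF t]])
  have "Re (s * cnj u) + Re (s * cnj v) + Re (s * cnj w) = Re (s * cnj (u + v + w))"
    by (simp add: algebra_simps)
  also have "s * cnj (u + v + w) = - of_real k" unfolding sum using ss by simp
  finally have "Re (s * cnj u) + Re (s * cnj v) + Re (s * cnj w) = - k" by simp
  with w have perimeter: "J * (d + e + f) = (9 - k\<^sup>2) / 2" by algebra
  have Re2: "2 * of_real (Re (s * cnj z)) = s * cnj z + cnj s * z" for z
    by (simp add: complex_eq_iff)
  \<comment> \<open>Multiplying the sides by \<open>u\<close>, \<open>v\<close>, \<open>w\<close>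
    produces the sum of the roots and the sum of their squares, both known from the cubic.\<close>
  have weighted: "of_real (J * d) * u + of_real (J * e) * v + of_real (J * f) * w
      = - 3 * of_real k * s - (of_real k)\<^sup>2 * cnj s"
  proof -
    have 1: "2 * of_real (J * d) = 3 - (of_real k)\<^sup>2 - of_real k * (s * cnj u + cnj s * u)"
      "2 * of_real (J * e) = 3 - (of_real k)\<^sup>2 - of_real k * (s * cnj v + cnj s * v)"
      "2 * of_real (J * f) = 3 - (of_real k)\<^sup>2 - of_real k * (s * cnj w + cnj s * w)"
      unfolding w Re2[symmetric] by (simp_all add: field_simps)
    have "2 * (of_real (J * d) * u + of_real (J * e) * v + of_real (J * f) * w)
       = 2 * (- 3 * of_real k * s - (of_real k)\<^sup>2 * cnj s)"
      using 1 sum sum2 ss unit_mult_cnj[OF n(1)] unit_mult_cnj[OF n(2)] unit_mult_cnj[OF n(3)]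
      by algebra
    then show ?thesis by (metis mult_left_cancel zero_neq_numeral)
  qed
  have bary: "of_real (J * (e + f)) * u + of_real (J * (f + d)) * v + of_real (J * (d + e)) * w
     = - (of_real k * (9 - (of_real k)\<^sup>2) / 2 - 3 * of_real k) * s + (of_real k)\<^sup>2 * cnj s"
  proof -
    have p: "complex_of_real (J * (d + e + f)) = (9 - (of_real k)\<^sup>2) / 2"
      unfolding perimeter by simp
    have "of_real (J * (e + f)) * u + of_real (J * (f + d)) * v + of_real (J * (d + e)) * w
      = complex_of_real (J * (d + e + f)) * (u + v + w)
       - (of_real (J * d) * u + of_real (J * e) * v + of_real (J * f) * w)"
      by (simp add: algebra_simps)
    then show ?thesis unfolding p sum weighted by (simp add: algebra_simps diff_divide_distrib)
  qed
  have h: "h_X10 d e f = Some ((e + f) / d)" "h_X10 e f d = Some ((f + d) / e)"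
    "h_X10 f d e = Some ((d + e) / f)"
    using pos by (simp_all add: h_X10_def)
  have total: "(e + f) / d * d + (f + d) / e * e + (d + e) / f * f = 2 * (d + e + f)"
    using pos by simp
  show "center_defined h_X10 P Q R"
    unfolding center_defined_def Let_def d_def[symmetric] e_def[symmetric] f_def[symmetric] h
    using total pos by simp
  have k9: "9 - k\<^sup>2 > 0" using k_less_1 k_pos power_less_one_iff[of k 2] by simp
  have S: "2 * (d + e + f) * J = 9 - k\<^sup>2" using perimeter by algebra
  have "center h_X10 P Q R = (1 / (2 * (d + e + f))) *\<^sub>R ((e + f) *\<^sub>R P + (f + d) *\<^sub>R Q + (d + e) *\<^sub>R R)"
    unfolding center_def Let_def d_def[symmetric] e_def[symmetric] f_def[symmetric] h option.sel total
    using pos by simp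
  also have "\<dots> = (1 / (9 - k\<^sup>2)) *\<^sub>R
      ((J * (e + f)) *\<^sub>R P + (J * (f + d)) *\<^sub>R Q + (J * (d + e)) *\<^sub>R R)"
    unfolding S[symmetric] scaleR_add_right scaleR_scaleR using J_pos pos by simp
  also have "(J * (e + f)) *\<^sub>R P + (J * (f + d)) *\<^sub>R Q + (J * (d + e)) *\<^sub>R R
     = (a * ((k\<^sup>2 + 3 * k - k * (9 - k\<^sup>2) / 2) * Re s), b * ((3 * k - k\<^sup>2 - k * (9 - k\<^sup>2) / 2) * Im s))"
  proof -
    have "Re (of_real (J * (e + f)) * u + of_real (J * (f + d)) * v + of_real (J * (d + e)) * w)
      = (k\<^sup>2 + 3 * k - k * (9 - k\<^sup>2) / 2) * Re s"
      "Im (of_real (J * (e + f)) * u + of_real (J * (f + d)) * v + of_real (J * (d + e)) * w)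
      = (3 * k - k\<^sup>2 - k * (9 - k\<^sup>2) / 2) * Im s"
      unfolding bary by (simp_all add: algebra_simps flip: of_real_power)
    moreover have "(J * (e + f)) *\<^sub>R P + (J * (f + d)) *\<^sub>R Q + (J * (d + e)) *\<^sub>R R
      = ellipse_pt a b (of_real (J * (e + f)) * u + of_real (J * (f + d)) * v + of_real (J * (d + e)) * w)"
      by (simp add: PQR ellipse_pt_def algebra_simps)
    ultimately show ?thesis by (simp only: ellipse_pt_def)
  qed
  also have "(1 / (9 - k\<^sup>2)) *\<^sub>R \<dots> = X10_pt s"
  proof -
    \<comment> \<open>\<open>k_eq\<close> factors as a^2 (k + 3)(k - 1) = b^2 (k - 3)(k + 1), which
      is why both coordinates lead to the same constant \<open>k10\<close>.\<close>
    have "a\<^sup>2 * (k\<^sup>2 + 3 * k - k * (9 - k\<^sup>2) / 2) = - k10 * (9 - k\<^sup>2)"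
      "b\<^sup>2 * (3 * k - k\<^sup>2 - k * (9 - k\<^sup>2) / 2) = - k10 * (9 - k\<^sup>2)"
      using k_eq k_pos unfolding k10_def by algebra+
    then have "a * (k\<^sup>2 + 3 * k - k * (9 - k\<^sup>2) / 2) / (9 - k\<^sup>2) = - (k10 / a)"
      "b * (3 * k - k\<^sup>2 - k * (9 - k\<^sup>2) / 2) / (9 - k\<^sup>2) = - (k10 / b)"
      using a_pos b_pos k9 by (simp_all add: field_simps power2_eq_square)
    then show ?thesis unfolding X10_pt_def by (simp add: mult.assoc[symmetric])
  qed
  finally show "center h_X10 P Q R = X10_pt s" .
qed

lemma locus_X10: "locus a b h_X10 = ellipse_set (k10 / a) (k10 / b)"
proof (intro set_eqI iffI)
  fix X assume "X \<in> locus a b h_X10"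
  then obtain P Q R where t: "three_periodic a b P Q R" and X: "X = center h_X10 P Q R"
    by (auto simp: locus_def)
  from three_periodic_imp_orbit_triple[OF t] obtain u v w where o: "orbit_triple k u v w"
    and "P = ellipse_pt a b u" "Q = ellipse_pt a b v" "R = ellipse_pt a b w" by metis
  then have "X = X10_pt (u * v * w)" using center_X10(2)[OF o] X by simp
  then show "X \<in> ellipse_set (k10 / a) (k10 / b)"
    using orbit_triple_product(1)[OF o] rotated_ellipse_parametrization[OF k10_pos] by (auto simp: X10_pt_def)
next
  fix X assume "X \<in> ellipse_set (k10 / a) (k10 / b)"
  then obtain s where "cmod s = 1" and X: "X = X10_pt s"
    using rotated_ellipse_parametrization[OF k10_pos] by (auto simp: X10_pt_def)
  then obtain u v w where o: "orbit_triple k u v w" "u * v * w = s"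
    using ex_orbit_triple k_pos k_less_1 by metis
  then show "X \<in> locus a b h_X10"
    using locus_I[OF orbit_triple_imp_three_periodic[OF o(1)] center_X10(1)[OF o(1)]]
      center_X10(2)[OF o(1)] X o(2) by simp
qed

section \<open>The orthocenter and its missing positions\<close>

lemma locus_X4_subset: "locus a b h_X4 \<subseteq> ellipse_set (k4 / a) (k4 / b)"
proof
  fix X assume "X \<in> locus a b h_X4"
  then obtain P Q R where t: "three_periodic a b P Q R" and d: "center_defined h_X4 P Q R"
    and X: "X = center h_X4 P Q R"
    by (auto simp: locus_def)
  from three_periodic_imp_orbit_triple[OF t] obtain u v w where o: "orbit_triple k u v w"
    and P: "P = ellipse_pt a b u" "Q = ellipse_pt a b v" "R = ellipse_pt a b w" by metis
  have "X = X4_pt (u * v * w)"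
    using center_X4(2)[OF nondegenerate_orbit_triple[OF o] _ altitudes_meet_orbit_triple[OF o]] d X P
    by simp
  then show "X \<in> ellipse_set (k4 / a) (k4 / b)"
    using orbit_triple_product(1)[OF o] rotated_ellipse_parametrization[OF k4_pos] by (auto simp: X4_pt_def)
qed

lemma locus_X4_superset: "ellipse_set (k4 / a) (k4 / b) - {X. on_ellipse a b X} \<subseteq> locus a b h_X4"
proof
  fix X assume "X \<in> ellipse_set (k4 / a) (k4 / b) - {X. on_ellipse a b X}"
  then have X_ell: "\<not> on_ellipse a b X" and "X \<in> ellipse_set (k4 / a) (k4 / b)" by auto
  then obtain s where "cmod s = 1" and X: "X = X4_pt s"
    using rotated_ellipse_parametrization[OF k4_pos] by (auto simp: X4_pt_def)
  then obtain u v w where o: "orbit_triple k u v w" "u * v * w = s"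
    using ex_orbit_triple k_pos k_less_1 by metis
  have not_right: "inner (ellipse_pt a b y - ellipse_pt a b x) (ellipse_pt a b z - ellipse_pt a b x) \<noteq> 0"
    if t: "orbit_triple k x y z" "x * y * z = s" for x y z
  proof
    assume "inner (ellipse_pt a b y - ellipse_pt a b x) (ellipse_pt a b z - ellipse_pt a b x) = 0"
    then have "X = ellipse_pt a b x"
      using altitudes_meet_right_angle[OF nondegenerate_orbit_triple[OF t(1)] altitudes_meet_orbit_triple[OF t(1)]]
      by (simp add: t X)
    then show False using X_ell t(1) on_ellipse_iff[OF a_pos b_pos] by (auto simp: orbit_triple_def)
  qed
  have d: "center_defined h_X4 (ellipse_pt a b u) (ellipse_pt a b v) (ellipse_pt a b w)"
    unfolding center_X4(1)[OF nondegenerate_orbit_triple[OF o(1)]]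
    using not_right o orbit_triple_rotate by (simp add: mult_ac)
  then have "center h_X4 (ellipse_pt a b u) (ellipse_pt a b v) (ellipse_pt a b w) = X"
    using center_X4(2)[OF nondegenerate_orbit_triple[OF o(1)] _ altitudes_meet_orbit_triple[OF o(1)]]
    by (simp add: o X)
  then show "X \<in> locus a b h_X4"
    using locus_I[OF orbit_triple_imp_three_periodic[OF o(1)] d] by simp
qed

text \<open>The two ellipse equations are linear in x^2 and y^2 with determinant a^4 - b^4, nonzero
  up to sign, so each coordinate has at most two values.\<close>

lemma finite_X4_on_ellipse: "finite (ellipse_set (k4 / a) (k4 / b) \<inter> {X. on_ellipse a b X})"
proof -
  define S where "S = (\<lambda>c::real. {x. x\<^sup>2 = c})"
  have fin: "finite (S c)" for c
  proof (rule finite_subset)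
    show "S c \<subseteq> {sqrt c, - sqrt c}" by (auto simp: S_def real_sqrt_abs abs_if)
  qed simp
  define D where "D = a ^ 4 - b ^ 4"
  have "D = (a\<^sup>2 - b\<^sup>2) * (a\<^sup>2 + b\<^sup>2)" unfolding D_def by algebra
  moreover have "0 < a\<^sup>2 + b\<^sup>2" using a_pos by (simp add: sum_power2_gt_zero_iff)
  ultimately have "0 < D" using c2_pos by (simp only: mult_pos_pos)
  then have D: "D \<noteq> 0" by simp
  have "ellipse_set (k4 / a) (k4 / b) \<inter> {X. on_ellipse a b X}
     \<subseteq> S ((k4\<^sup>2 * a\<^sup>2 - a\<^sup>2 * b ^ 4) / D) \<times> S ((a ^ 4 * b\<^sup>2 - k4\<^sup>2 * b\<^sup>2) / D)"
  proof clarify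
    fix x y assume "(x, y) \<in> ellipse_set (k4 / a) (k4 / b)" "on_ellipse a b (x, y)"
    then have 1: "a\<^sup>2 * x\<^sup>2 + b\<^sup>2 * y\<^sup>2 = k4\<^sup>2" "b\<^sup>2 * x\<^sup>2 + a\<^sup>2 * y\<^sup>2 = a\<^sup>2 * b\<^sup>2"
      using k4_pos a_pos b_pos by (simp_all add: ellipse_set_def on_ellipse_def field_simps)
    then have "D * x\<^sup>2 = k4\<^sup>2 * a\<^sup>2 - a\<^sup>2 * b ^ 4" "D * y\<^sup>2 = a ^ 4 * b\<^sup>2 - k4\<^sup>2 * b\<^sup>2"
      unfolding D_def by algebra+
    then show "x \<in> S ((k4\<^sup>2 * a\<^sup>2 - a\<^sup>2 * b ^ 4) / D) \<and> y \<in> S ((a ^ 4 * b\<^sup>2 - k4\<^sup>2 * b\<^sup>2) / D)"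
      using D by (simp add: S_def field_simps)
  qed
  then show ?thesis using fin by (meson finite_SigmaI finite_subset)
qed

text \<open>As a continuous image of the unit circle the ellipse is connected, and a connected set
  with more than one point has no isolated points.\<close>

lemma ellipse_set_islimpt:
  assumes "X \<in> ellipse_set (k4 / a) (k4 / b)"
  shows "X islimpt ellipse_set (k4 / a) (k4 / b)"
proof (rule connected_imp_perfect[OF _ assms])
  have E: "ellipse_set (k4 / a) (k4 / b) = X4_pt ` sphere 0 1"
    unfolding set_eq_iff rotated_ellipse_parametrization[OF k4_pos] X4_pt_def image_iff by auto
  show "connected (ellipse_set (k4 / a) (k4 / b))" unfolding E
    using a_pos b_pos by (intro connected_continuous_image connected_sphere)
       (auto simp: X4_pt_def[abs_def] intro!: continuous_intros)
  have "X4_pt 1 \<in> ellipse_set (k4 / a) (k4 / b)" "X4_pt (- 1) \<in> ellipse_set (k4 / a) (k4 / b)"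
    unfolding E by auto
  moreover have "X4_pt 1 \<noteq> X4_pt (- 1)" using k4_pos a_pos by (simp add: X4_pt_def)
  ultimately show "ellipse_set (k4 / a) (k4 / b) \<noteq> {x}" for x by (metis singletonD)
qed

text \<open>Deleting finitely many points from a set preserves its limit points, so the closure
  restores the positions lost to right angles.\<close>

lemma closure_locus_X4: "closure (locus a b h_X4) = ellipse_set (k4 / a) (k4 / b)"
proof
  have "closed (ellipse_set (k4 / a) (k4 / b))"
    unfolding ellipse_set_def by (intro closed_Collect_eq continuous_intros) (use k4_pos a_pos b_pos in auto)
  then show "closure (locus a b h_X4) \<subseteq> ellipse_set (k4 / a) (k4 / b)"
    by (rule closure_minimal[OF locus_X4_subset])
  show "ellipse_set (k4 / a) (k4 / b) \<subseteq> closure (locus a b h_X4)"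
  proof
    fix X assume "X \<in> ellipse_set (k4 / a) (k4 / b)"
    then have "X islimpt ellipse_set (k4 / a) (k4 / b)" by (rule ellipse_set_islimpt)
    then have "X islimpt ((ellipse_set (k4 / a) (k4 / b) \<inter> {X. on_ellipse a b X})
        \<union> (ellipse_set (k4 / a) (k4 / b) - {X. on_ellipse a b X}))"
      by (simp add: Int_Diff_Un)
    then have "X islimpt (ellipse_set (k4 / a) (k4 / b) - {X. on_ellipse a b X})"
      by (subst (asm) islimpt_Un_finite[OF finite_X4_on_ellipse])
    then have "X islimpt locus a b h_X4" using locus_X4_superset islimpt_subset by blast
    then show "X \<in> closure (locus a b h_X4)" by (simp add: closure_def)
  qed
qed

end

theorem theorem1:
  fixes a b :: real
  assumes "a > b" and "b > 0"
  defines "c2 \<equiv> a\<^sup>2 - b\<^sup>2"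
      and "\<delta> \<equiv> sqrt (a^4 - a\<^sup>2 * b\<^sup>2 + b^4)"
  defines "k4 \<equiv> ((a\<^sup>2 + b\<^sup>2) * \<delta> - 2 * a\<^sup>2 * b\<^sup>2) / c2"
      and "k10 \<equiv> ((a\<^sup>2 + b\<^sup>2) * \<delta> - a^4 - b^4) / (2 * c2)"
  shows "closure (locus a b h_X4) = ellipse_set (k4 / a) (k4 / b) \<and>
         locus a b h_X10 = ellipse_set (k10 / a) (k10 / b)"
proof -
  \<comment> \<open>The positive root of c2 k^2 + 2 (a^2 + b^2) k - 3 c2 = 0, whose reduced
    discriminant (a^2 + b^2)^2 + 3 c2^2 equals 4 \<open>\<delta>\<close> squared.\<close>
  define k where "k = (2 * \<delta> - a\<^sup>2 - b\<^sup>2) / c2"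
  have c2: "0 < c2" using assms(1,2) by (simp add: c2_def power_strict_mono)
  have nonneg: "a^4 - a\<^sup>2 * b\<^sup>2 + b^4 = c2\<^sup>2 + a\<^sup>2 * b\<^sup>2" unfolding c2_def by algebra
  have d2: "\<delta>\<^sup>2 = a^4 - a\<^sup>2 * b\<^sup>2 + b^4" unfolding \<delta>_def nonneg by simp
  have d0: "0 \<le> \<delta>" unfolding \<delta>_def nonneg by simp
  have kc: "k * c2 = 2 * \<delta> - a\<^sup>2 - b\<^sup>2" using c2 by (simp add: k_def)
  have "(a\<^sup>2 + b\<^sup>2)\<^sup>2 < (2 * \<delta>)\<^sup>2"
  proof -
    have "(2 * \<delta>)\<^sup>2 = (a\<^sup>2 + b\<^sup>2)\<^sup>2 + 3 * c2\<^sup>2" using d2 unfolding c2_def by algebra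
    then show ?thesis using c2 by simp
  qed
  then have "a\<^sup>2 + b\<^sup>2 < 2 * \<delta>" by (rule power2_less_imp_less) (use d0 in linarith)
  then have k_pos: "0 < k" using c2 by (simp add: k_def)
  \<comment> \<open>The bound k < 1 amounts to \<open>\<delta> < a\<^sup>2\<close>.\<close>
  have "\<delta>\<^sup>2 < (a\<^sup>2)\<^sup>2"
  proof -
    have "(a\<^sup>2)\<^sup>2 = \<delta>\<^sup>2 + b\<^sup>2 * c2" using d2 unfolding c2_def by algebra
    then show ?thesis using c2 assms(2) by simp
  qed
  then have "\<delta> < a\<^sup>2" by (rule power2_less_imp_less) (rule zero_le_power2)
  then have k_less_1: "k < 1" using c2 by (simp add: k_def c2_def)
  have "c2 * (k\<^sup>2 * c2 + 2 * k * (a\<^sup>2 + b\<^sup>2)) = c2 * (3 * c2)"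
    using kc d2 unfolding c2_def by algebra
  then have "k\<^sup>2 * c2 + 2 * k * (a\<^sup>2 + b\<^sup>2) = 3 * c2" using c2 by simp
  then interpret elliptic_billiard a b k
    using assms(1,2) k_pos k_less_1 by unfold_locales (simp_all add: c2_def)
  have "k4 = elliptic_billiard.k4 a b k"
  proof -
    have "2 * elliptic_billiard.k4 a b k = k * (a\<^sup>2 + b\<^sup>2) + c2"
      by (simp add: k4_def c2_def)
    then have "2 * c2 * elliptic_billiard.k4 a b k = (a\<^sup>2 + b\<^sup>2) * (k * c2) + c2\<^sup>2"
      by algebra
    also have "\<dots> = 2 * ((a\<^sup>2 + b\<^sup>2) * \<delta> - 2 * a\<^sup>2 * b\<^sup>2)"
      using kc unfolding c2_def by algebra
    finally show ?thesis using c2 by (simp add: assms(5) field_simps)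
  qed
  moreover have "k10 = elliptic_billiard.k10 a b k"
  proof -
    have "4 * elliptic_billiard.k10 a b k = k * (a\<^sup>2 + b\<^sup>2) - c2"
      by (simp add: k10_def c2_def)
    then have "4 * c2 * elliptic_billiard.k10 a b k = (a\<^sup>2 + b\<^sup>2) * (k * c2) - c2\<^sup>2"
      by algebra
    also have "\<dots> = 2 * ((a\<^sup>2 + b\<^sup>2) * \<delta> - a^4 - b^4)"
      using kc unfolding c2_def by algebra
    finally show ?thesis using c2 by (simp add: assms(6) field_simps)
  qed
  ultimately show ?thesis using closure_locus_X4 locus_X10 by simp
qed

end
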